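(* Let $x$ be such that $q_1(x)\ge1-\alpha\ge0.9$. If $\Gamma(\alpha)$ and $K(\alpha)$ are as in the context, then $$\left|q_n-\frac{6(q_1-q_2)^2+4q_3-3q_4}{(1+q_1-q_2+q_3-q_4+2q_1^2+3q_2^2-5q_1q_2)^n}\right|\le\Delta_1(1-q_1)^3$$ with $$\Delta_1=\Delta_1(\alpha,n)=\Gamma(\alpha)+nK(\alpha).$$
   Context: $(X_n)_{n\ge1}$ is a strictly stationary sequence of random variables that is 1-dependent, i.e. for every $t\ge1$ the $\sigma$-fields $\sigma(X_1,\dots,X_t)$ and $\sigma(X_{t+2},X_{t+3},\dots)$ are independent. Let $F(u)=\mathbb{P}(X_1\le u)$, and let the real number $x$ satisfy $\inf\{u: F(u)>0\}<x<\sup\{u: F(u)<1\}$. For $n\ge1$ put $q_n=q_n(x)=\mathbb{P}(\max\{X_1,\dots,X_n\}\le x)$. Let $l=l(\alpha)>t_2^3(\alpha)$, where $t_2(\alpha)$ is the second root (in increasing order) of the equation $\alpha t^3-t+1=0$, and put $\eta=1+l\alpha$, $$K(\alpha)=\frac{\dfrac{11-3\alpha}{(1-\alpha)^2}+2l(1+3\alpha)\dfrac{2+3l\alpha-\alpha(2-l\alpha)(1+l\alpha)^2}{\left[1-\alpha(1+l\alpha)^2\right]^3}}{1-\dfrac{2\alpha(1+l\alpha)}{\left[1-\alpha(1+l\alpha)^2\right]^2}},$$ $$L(\alpha)=3K(\alpha)(1+\alpha+3\alpha^2)\left[1+\alpha+3\alpha^2+K(\alpha)\alpha^3\right]+\alpha^6K^3(\alpha)+9\alpha(4+3\alpha+3\alpha^2)+55,$$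 $$E(\alpha)=0.1+\frac{\eta^5\left[1+(1-2\alpha)\eta\right]^4\left[1+\alpha(\eta-2)\right]\left[1+\eta+(1-3\alpha)\eta^2\right]}{2(1-\alpha\eta^2)^4\left[(1-\alpha\eta^2)^2-\alpha\eta^2(1+\eta-2\alpha\eta)^2\right]},$$ $$\Gamma(\alpha)=L(\alpha)+E(\alpha).$$
   Formalization: The formal theorem assumes n ≥ 3 (the bound fails for n = 1, 2) and that 1−αη², the denominator of K(α), and the last bracket in the denominator of E(α) are positive (true for l near t_2³(α); for large l, Γ(α) can be negative and the bound fails). *)

theory Defs
  imports "HOL-Probability.Probability"
begin

text \<open>
  Sequences are indexed from 1: for \<open>X :: nat \<Rightarrow> 'a \<Rightarrow> real\<close> only the values \<open>X i\<close>
  with \<open>i \<ge> 1\<close> matter, and \<open>X 0\<close> is never used.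
\<close>

definition strictly_stationary :: "'a measure \<Rightarrow> (nat \<Rightarrow> 'a \<Rightarrow> real) \<Rightarrow> bool" where
  "strictly_stationary M X \<longleftrightarrow>
     (\<forall>J h. finite J \<longrightarrow> J \<subseteq> {1..} \<longrightarrow>
        distr M (PiM J (\<lambda>_. borel)) (\<lambda>\<omega>. \<lambda>i\<in>J. X (i + h) \<omega>) =
        distr M (PiM J (\<lambda>_. borel)) (\<lambda>\<omega>. \<lambda>i\<in>J. X i \<omega>))"

definition generated_sigma_field :: "'a measure \<Rightarrow> (nat \<Rightarrow> 'a \<Rightarrow> real) \<Rightarrow> nat set \<Rightarrow> 'a set set" where
  "generated_sigma_field M X I =
     sigma_sets (space M) {X i -` B \<inter> space M | i B. i \<in> I \<and> B \<in> sets borel}"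

definition one_dependent :: "'a measure \<Rightarrow> (nat \<Rightarrow> 'a \<Rightarrow> real) \<Rightarrow> bool" where
  "one_dependent M X \<longleftrightarrow>
     (\<forall>t\<ge>1. prob_space.indep_set M (generated_sigma_field M X {1..t})
                                    (generated_sigma_field M X {t + 2..}))"

definition F :: "'a measure \<Rightarrow> (nat \<Rightarrow> 'a \<Rightarrow> real) \<Rightarrow> real \<Rightarrow> real" where
  "F M X u = measure M {\<omega> \<in> space M. X 1 \<omega> \<le> u}"

definition q :: "'a measure \<Rightarrow> (nat \<Rightarrow> 'a \<Rightarrow> real) \<Rightarrow> real \<Rightarrow> nat \<Rightarrow> real" where
  "q M X x n = measure M {\<omega> \<in> space M. Max ((\<lambda>i. X i \<omega>) ` {1..n}) \<le> x}"

text \<open>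
  For \<open>0 < \<alpha> < 4/27\<close> the cubic has three real roots, one negative and two positive, so
  list position 1 (the second entry) holds the smaller positive root.
\<close>

definition t2 :: "real \<Rightarrow> real" where
  "t2 \<alpha> = sorted_list_of_set {t. \<alpha> * t ^ 3 - t + 1 = 0} ! 1"

definition \<eta> :: "real \<Rightarrow> real \<Rightarrow> real" where
  "\<eta> l \<alpha> = 1 + l * \<alpha>"

definition K :: "real \<Rightarrow> real \<Rightarrow> real" where
  "K l \<alpha> =
     ((11 - 3 * \<alpha>) / (1 - \<alpha>)\<^sup>2
       + 2 * l * (1 + 3 * \<alpha>)
         * ((2 + 3 * l * \<alpha> - \<alpha> * (2 - l * \<alpha>) * (1 + l * \<alpha>)\<^sup>2)
            / (1 - \<alpha> * (1 + l * \<alpha>)\<^sup>2) ^ 3))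
     / (1 - 2 * \<alpha> * (1 + l * \<alpha>) / (1 - \<alpha> * (1 + l * \<alpha>)\<^sup>2)\<^sup>2)"

definition L :: "real \<Rightarrow> real \<Rightarrow> real" where
  "L l \<alpha> =
     3 * K l \<alpha> * (1 + \<alpha> + 3 * \<alpha>\<^sup>2) * (1 + \<alpha> + 3 * \<alpha>\<^sup>2 + K l \<alpha> * \<alpha> ^ 3)
     + \<alpha> ^ 6 * K l \<alpha> ^ 3 + 9 * \<alpha> * (4 + 3 * \<alpha> + 3 * \<alpha>\<^sup>2) + 55"

definition E :: "real \<Rightarrow> real \<Rightarrow> real" where
  "E l \<alpha> = 0.1 +
     (\<eta> l \<alpha> ^ 5 * (1 + (1 - 2 * \<alpha>) * \<eta> l \<alpha>) ^ 4 * (1 + \<alpha> * (\<eta> l \<alpha> - 2))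
       * (1 + \<eta> l \<alpha> + (1 - 3 * \<alpha>) * (\<eta> l \<alpha>)\<^sup>2))
     / (2 * (1 - \<alpha> * (\<eta> l \<alpha>)\<^sup>2) ^ 4
        * ((1 - \<alpha> * (\<eta> l \<alpha>)\<^sup>2)\<^sup>2 - \<alpha> * (\<eta> l \<alpha>)\<^sup>2 * (1 + \<eta> l \<alpha> - 2 * \<alpha> * \<eta> l \<alpha>)\<^sup>2))"

definition \<Gamma> :: "real \<Rightarrow> real \<Rightarrow> real" where
  "\<Gamma> l \<alpha> = L l \<alpha> + E l \<alpha>"

definition \<Delta>\<^sub>1 :: "real \<Rightarrow> real \<Rightarrow> nat \<Rightarrow> real" where
  "\<Delta>\<^sub>1 l \<alpha> n = \<Gamma> l \<alpha> + real n * K l \<alpha>"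

text \<open>
  The approximation of \<open>q\<close> within \<open>\<Delta>\<^sub>1 * (1 - q M X x 1) ^ 3\<close> needs \<open>n \<ge> 3\<close>: it fails for \<open>n = 1\<close>
  and \<open>n = 2\<close> when \<open>X i\<close> is the product of the \<open>i\<close>-th and \<open>(i+1)\<close>-th of i.i.d. Bernoulli
  variables whose success probability is small, with \<open>x = 1/2\<close> and \<open>\<alpha> = 1 - q M X x 1\<close>.

  The three expressions whose positivity makes \<open>K\<close> and \<open>E\<close> meaningful as upper bounds. They are
  positive for every \<open>l\<close> slightly larger than \<open>t2 \<alpha> ^ 3\<close>; for large \<open>l\<close> they fail and \<open>\<Gamma>\<close> can be
  negative (e.g. \<open>\<alpha> = 0.1\<close>, \<open>l = 10000\<close> gives \<open>\<Gamma> < -2500\<close> and \<open>K < 14\<close>).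
\<close>

definition positive_denominators :: "real \<Rightarrow> real \<Rightarrow> bool" where
  "positive_denominators l \<alpha> \<longleftrightarrow>
     0 < 1 - \<alpha> * (\<eta> l \<alpha>)\<^sup>2 \<and>
     0 < 1 - 2 * \<alpha> * \<eta> l \<alpha> / (1 - \<alpha> * (\<eta> l \<alpha>)\<^sup>2)\<^sup>2 \<and>
     0 < (1 - \<alpha> * (\<eta> l \<alpha>)\<^sup>2)\<^sup>2 - \<alpha> * (\<eta> l \<alpha>)\<^sup>2 * (1 + \<eta> l \<alpha> - 2 * \<alpha> * \<eta> l \<alpha>)\<^sup>2"

end

theory Submission
  imports Defs
begin

text \<open>
  Let \<open>p = 1 - q\<^sub>1\<close> be the probability that a single term exceeds \<open>x\<close>, and \<open>p\<^sub>k\<close> the probability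
  that \<open>k\<close> consecutive terms all do. Write \<open>u m k\<close> for the probability that the first \<open>m\<close> terms
  stay below \<open>x\<close> and the next \<open>k\<close> exceed it. If the condition on term \<open>m + 1\<close> is dropped from
  \<open>u (m + 1) k\<close>, two blocks separated by a gap remain, and one-dependence and stationarity give
  \<open>u (m + 1) k + u m (k + 1) = q\<^sub>m p\<^sub>k\<close>. Iterating this identity yields
  \[ q_{n-1} - q_n = p_1 q_{n-2} - p_2 q_{n-3} + p_3 q_{n-4} - p_4 q_{n-5} + r, \]
  where \<open>0 \<le> r \<le> p\<^sub>5\<close>. Deleting every other term of a run leaves independent exceedances, so
  \<open>p\<^sub>3 \<le> p\<^sup>2\<close> and \<open>p\<^sub>5 \<le> p\<^sup>3\<close>, and \<open>r\<close> is of third order.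

  Let \<open>\<mu>\<close> be the number whose \<open>n\<close>-th power is the denominator in the theorem and \<open>\<nu>\<close> the numerator.
  In terms of the \<open>p\<^sub>k\<close>, with \<open>s = p\<^sub>1 - p\<^sub>2\<close>, one has exactly
  \<open>\<mu> = 1 + s (1 + 2 p\<^sub>1 - 3 p\<^sub>2) + p\<^sub>3 - p\<^sub>4\<close> (lemma \<open>\<mu>_eq\<close>). This is what the recursion produces when
  \<open>q\<^sub>n\<^sub>-\<^sub>2\<close> and \<open>q\<^sub>n\<^sub>-\<^sub>3\<close> are replaced by \<open>(1 + 2 s) q\<^sub>n\<close> and \<open>(1 + 3 s) q\<^sub>n\<close>: up to third
  order, \<open>q\<^sub>n\<^sub>-\<^sub>1 = \<mu> q\<^sub>n\<close>. Lemma \<open>Q_step\<close> makes this \<open>\<bar>\<mu> q\<^sub>n - q\<^sub>n\<^sub>-\<^sub>1\<bar> \<le> 12 p\<^sup>3\<close> for \<open>n \<ge> 4\<close>.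
  Likewise \<open>\<nu>\<close> agrees with \<open>\<mu>\<^sup>3 q\<^sub>3\<close> up to terms of third order, which \<open>initial_error_bound\<close>
  bounds by \<open>109 p\<^sup>3\<close>.

  Since \<open>\<mu> \<ge> 1\<close>, passing from \<open>n - 1\<close> to \<open>n\<close> does not amplify the error \<open>q\<^sub>n - \<nu> / \<mu> ^ n\<close> already
  present, so the one-step errors just add up to \<open>(109 + 12 (n - 3)) p\<^sup>3\<close> (lemma \<open>Q_approx\<close>). This
  avoids locating the dominant zero of the generating function of the \<open>p\<^sub>k\<close>.
  Finally \<open>K \<ge> 15\<close> and \<open>\<Gamma> \<ge> 100\<close> for all admissible \<open>\<alpha>\<close> and \<open>l\<close>; these are essentially the
  values in the limit \<open>\<alpha> \<rightarrow> 0\<close>, \<open>l \<rightarrow> 1\<close> of \<open>K\<close> and of the summand \<open>L\<close>, and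
  \<open>109 + 12 (n - 3) \<le> 100 + 15 n\<close>.
\<close>

section \<open>The recursion for runs of exceedances\<close>

text \<open>
  Here \<open>u m k\<close> stands for the probability that the first \<open>m\<close> terms are non-exceedances and the next
  \<open>k\<close> are exceedances. The assumption \<open>u_split\<close> comes from dropping the condition on term \<open>m + 1\<close>,
  and \<open>u_skip\<close> from dropping the last but one of \<open>k + 2\<close> exceedances. All later estimates of
  the probabilities follow from these four properties.
\<close>

locale exceedance_runs =
  fixes u :: "nat \<Rightarrow> nat \<Rightarrow> real"
  assumes u_nonneg: "u m k \<ge> 0"
    and u_00: "u 0 0 = 1"
    and u_split: "u (Suc m) k + u m (Suc k) = u m 0 * u 0 k"
    and u_skip: "u 0 (Suc (Suc k)) \<le> u 0 k * u 0 1"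
begin

abbreviation Q :: "nat \<Rightarrow> real" where "Q n \<equiv> u n 0"
abbreviation P :: "nat \<Rightarrow> real" where "P k \<equiv> u 0 k"

lemma P_decreasing: "P (Suc k) \<le> P k"
  using u_split[of 0 k] u_nonneg[of 1 k] u_00 by simp

lemma Q_diff: "Q m - Q (Suc m) = u m 1"
  using u_split[of m 0] u_00 by simp

lemma Q_le_1: "Q n \<le> 1"
proof (induction n)
  case (Suc n)
  then show ?case using Q_diff[of n] u_nonneg[of n 1] by simp
qed (simp add: u_00)

lemma u_le_P: "u m k \<le> P k"
proof (cases m)
  case (Suc i)
  have "u (Suc i) k \<le> Q i * P k"
    using u_split[of i k] u_nonneg[of i "Suc k"] by simp
  also have "\<dots> \<le> 1 * P k"
    by (intro mult_right_mono Q_le_1 u_nonneg)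
  finally show ?thesis using Suc by simp
qed simp

lemma Q_diff_bounds: "0 \<le> Q m - Q (Suc m)" "Q m - Q (Suc m) \<le> P 1"
  unfolding Q_diff by (rule u_nonneg, rule u_le_P)

text \<open>
  With the convention \<open>Q (-1) = 1\<close> the splitting identity extends to \<open>m = -1\<close> with error term 0,
  since then both sides are \<open>P k\<close>. The one-step estimate for \<open>n\<close> involves \<open>Q (n - 5)\<close>, and this
  convention lets it start at \<open>n = 4\<close>.
\<close>

definition Q_prev :: "nat \<Rightarrow> real" where
  "Q_prev m = (case m of 0 \<Rightarrow> 1 | Suc i \<Rightarrow> Q i)"

lemma Q_prev_diff: "0 \<le> Q_prev m - Q m" "Q_prev m - Q m \<le> P 1"
  using Q_diff_bounds u_nonneg[of 0 1] u_00
  by (simp_all add: Q_prev_def split: nat.split)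

lemma u_split_prev: "\<exists>r. u m k = Q_prev m * P k - r \<and> 0 \<le> r \<and> r \<le> P (Suc k)"
proof (cases m)
  case 0
  then show ?thesis by (intro exI[of _ 0]) (simp add: Q_prev_def u_nonneg)
next
  case (Suc i)
  then show ?thesis using u_split[of i k] u_nonneg[of i "Suc k"] u_le_P[of i "Suc k"]
    by (intro exI[of _ "u i (Suc k)"]) (simp add: Q_prev_def)
qed

text \<open>
  Exceedances at distance two are independent, so a run of length three or five is as rare as two
  or three independent exceedances.
\<close>

lemma P_bounds:
  shows "P 3 \<le> (P 1)\<^sup>2" "P 5 \<le> (P 1) ^ 3"
proof -
  show "P 3 \<le> (P 1)\<^sup>2"
    using u_skip[of 1] by (simp add: numeral_eq_Suc power2_eq_square)
  moreover have "P 5 \<le> P 3 * P 1"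
    using u_skip[of 3] by (simp add: numeral_eq_Suc)
  ultimately show "P 5 \<le> (P 1) ^ 3"
    using mult_right_mono[of "P 3" "(P 1)\<^sup>2" "P 1"] u_nonneg[of 0 1]
    by (simp add: power3_eq_cube power2_eq_square)
qed

definition \<mu> :: real where
  "\<mu> = 1 + Q 1 - Q 2 + Q 3 - Q 4 + 2 * (Q 1)\<^sup>2 + 3 * (Q 2)\<^sup>2 - 5 * Q 1 * Q 2"

definition \<nu> :: real where
  "\<nu> = 6 * (Q 1 - Q 2)\<^sup>2 + 4 * Q 3 - 3 * Q 4"

lemma Q_first:
  "Q 1 = 1 - P 1"
  "Q 2 = 1 - 2 * P 1 + P 2"
  "Q 3 = 1 - 3 * P 1 + 2 * P 2 + (P 1)\<^sup>2 - P 3"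
  "Q 4 = Q 3 - P 1 * Q 2 + P 2 * Q 1 - P 3 + P 4"
proof -
  show q1: "Q 1 = 1 - P 1"
    using Q_diff[of 0] u_00 by simp
  have u11: "u 1 1 = P 1 - P 2"
    using u_split[of 0 1] u_00 by (simp add: numeral_eq_Suc)
  show q2: "Q 2 = 1 - 2 * P 1 + P 2"
    using Q_diff[of 1] u11 q1 by (simp add: numeral_eq_Suc)
  have u12: "u 1 2 = P 2 - P 3"
    using u_split[of 0 2] u_00 by (simp add: numeral_eq_Suc)
  have u21: "u 2 1 = Q 1 * P 1 - u 1 2"
    using u_split[of 1 1] by (simp add: numeral_eq_Suc)
  show q3: "Q 3 = 1 - 3 * P 1 + 2 * P 2 + (P 1)\<^sup>2 - P 3"
  proof -
    have "Q 1 * P 1 = P 1 - (P 1)\<^sup>2" unfolding q1 by (simp add: power2_eq_square algebra_simps)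
    then show ?thesis using Q_diff[of 2] u21 u12 q2 by (simp add: eval_nat_numeral)
  qed
  have u13: "u 1 3 = P 3 - P 4"
    using u_split[of 0 3] u_00 by (simp add: numeral_eq_Suc)
  have u22: "u 2 2 = Q 1 * P 2 - u 1 3"
    using u_split[of 1 2] by (simp add: numeral_eq_Suc)
  have u31: "u 3 1 = Q 2 * P 1 - u 2 2"
    using u_split[of 2 1] by (simp add: numeral_eq_Suc)
  show "Q 4 = Q 3 - P 1 * Q 2 + P 2 * Q 1 - P 3 + P 4"
    using Q_diff[of 3] u31 u22 u13
    by (simp add: numeral_eq_Suc algebra_simps)
qed

text \<open>
  Expressed in the \<open>P k\<close>, the orders of magnitude become visible: \<open>P 1\<close> and \<open>P 2\<close> are of first
  order, \<open>P 3\<close> and \<open>P 4\<close> of second order.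
\<close>

lemma \<mu>_eq: "\<mu> = 1 + (P 1 - P 2) * (1 + 2 * P 1 - 3 * P 2) + (P 3 - P 4)"
  unfolding \<mu>_def Q_first by (simp add: power2_eq_square algebra_simps)

lemma \<nu>_eq: "\<nu> = 1 - P 2 + (P 1)\<^sup>2 - 6 * P 2 * (P 1 - P 2) + 2 * P 3 - 3 * P 4"
  unfolding \<nu>_def Q_first by (simp add: power2_eq_square algebra_simps)

end

section \<open>Third-order error bounds\<close>

lemma abs_mult_le:
  fixes a b x y :: real
  assumes "\<bar>x\<bar> \<le> a" "\<bar>y\<bar> \<le> b"
  shows "\<bar>x * y\<bar> \<le> a * b"
  unfolding abs_mult using assms by (intro mult_mono) auto

lemma divide_le_numerator:
  fixes c x :: real
  assumes "1 \<le> c" "0 \<le> x"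
  shows "x / c \<le> x"
  using divide_left_mono[of 1 c x] assms by simp

text \<open>
  Here \<open>q0, ..., q4\<close> are five consecutive terms \<open>Q m, ..., Q (m + 4)\<close> and \<open>a\<close> is the term before
  them; \<open>e2\<close>, \<open>e3\<close>, \<open>e4\<close> expand successive differences to first order and \<open>e4'\<close> expands the last one
  to second order. Subtracting \<open>e4'\<close> leaves the deviations \<open>T1\<close> and \<open>T2\<close> of \<open>q2 - q4\<close> and
  \<open>q1 - q2\<close> from \<open>2 * s * q4\<close> and \<open>s * q4\<close>. Both are of second order by \<open>e2\<close>, \<open>e3\<close>, \<open>e4\<close>, and they
  occur multiplied by the first-order quantities \<open>s\<close> and \<open>p2\<close>. The identity \<open>s + p2 = p\<close> lets
  these two contributions share one factor \<open>p\<close>, which keeps the total at \<open>7 + 4 + 1 = 12\<close>.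
\<close>

lemma one_step_error_bound:
  fixes p p2 p3 p4 a q0 q1 q2 q3 q4 r3 r5 v w :: real
  defines "s \<equiv> p - p2"
  assumes p: "0 \<le> p2" "p2 \<le> p" "0 \<le> p4" "p4 \<le> p3" "p3 \<le> p\<^sup>2"
    and q4: "0 \<le> q4"
    and d0: "0 \<le> a - q0" "a - q0 \<le> p"
    and d1: "0 \<le> q0 - q1" "q0 - q1 \<le> p"
    and d2: "0 \<le> q1 - q2" "q1 - q2 \<le> p"
    and d3: "0 \<le> q2 - q3" "q2 - q3 \<le> p"
    and d4: "0 \<le> q3 - q4" "q3 - q4 \<le> p"
    and e2: "q1 - q2 = p * q0 - p2 * a + r3"
    and e3: "q2 - q3 = p * q1 - p2 * q0 + v"
    and e4: "q3 - q4 = p * q2 - p2 * q1 + w"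
    and e4': "q3 - q4 = p * q2 - p2 * q1 + p3 * q0 - p4 * a + r5"
    and r: "0 \<le> r3" "r3 \<le> p3" "0 \<le> v" "v \<le> p3" "0 \<le> w" "w \<le> p3" "0 \<le> r5" "r5 \<le> p ^ 3"
  shows "\<bar>(1 + s * (1 + 2 * p - 3 * p2) + (p3 - p4)) * q4 - q3\<bar> \<le> 12 * p ^ 3"
proof -
  have p0: "0 \<le> p" and s: "0 \<le> s" "s \<le> p" using p by (auto simp: s_def)
  define T1 where "T1 = q2 - q4 - 2 * s * q4"
  define T2 where "T2 = q1 - q2 - s * q4"
  have X: "(1 + s * (1 + 2 * p - 3 * p2) + (p3 - p4)) * q4 - q3 =
    - (s * T1 - p2 * T2 + (p3 - p4) * (q0 - q4) - p4 * (a - q0) + r5)"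
    using e4' unfolding T1_def T2_def s_def by (simp add: algebra_simps)
  have T1: "T1 = s * ((q1 - q4) + (q2 - q4)) - p2 * ((q0 - q1) + (q1 - q2)) + v + w"
    using e3 e4 unfolding T1_def s_def by (simp add: algebra_simps)
  have T2: "T2 = s * (q0 - q4) - p2 * (a - q0) + r3"
    using e2 unfolding T2_def s_def by (simp add: algebra_simps)
  have sp: "s * y \<le> p * c" if "y \<le> c" "0 \<le> y" for y c
    using mult_mono[OF s(2) that(1)] that(2) p0 by simp
  have b1: "0 \<le> s * ((q1 - q4) + (q2 - q4))" "s * ((q1 - q4) + (q2 - q4)) \<le> p * (5 * p)"
    using d1 d2 d3 d4 s by (auto intro!: sp)
  have b2: "0 \<le> p2 * ((q0 - q1) + (q1 - q2))" "p2 * ((q0 - q1) + (q1 - q2)) \<le> p2 * (2 * p)"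
    using d1 d2 p by (auto intro!: mult_left_mono)
  have T1u: "T1 \<le> 7 * p\<^sup>2" and T1l: "- (2 * p2 * p) \<le> T1"
    using T1 b1 b2 r p by (auto simp: power2_eq_square)
  have b3: "0 \<le> s * (q0 - q4)" "s * (q0 - q4) \<le> p * (4 * p)"
    using d1 d2 d3 d4 s by (auto intro!: sp)
  have b4: "0 \<le> p2 * (a - q0)" "p2 * (a - q0) \<le> p2 * p"
    using d0 p by (auto intro!: mult_left_mono)
  have b4': "p2 * p \<le> p\<^sup>2" using p p0 by (simp add: power2_eq_square mult_right_mono)
  have T2u: "T2 \<le> 5 * p\<^sup>2" and T2l: "- p\<^sup>2 \<le> T2"
    using T2 b3 b4 b4' r p by (auto simp: power2_eq_square)
  have T1l': "- (2 * p\<^sup>2) \<le> T1" using T1l b4' by simp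
  have c1: "s * T1 \<le> s * (7 * p\<^sup>2)" "- (s * (2 * p\<^sup>2)) \<le> s * T1"
    using mult_left_mono[OF T1u s(1)] mult_left_mono[OF T1l' s(1)] by simp_all
  have c2: "p2 * T2 \<le> p2 * (5 * p\<^sup>2)" "- (p2 * p\<^sup>2) \<le> p2 * T2"
    using mult_left_mono[OF T2u p(1)] mult_left_mono[OF T2l p(1)] by simp_all
  have c12u: "s * (7 * p\<^sup>2) + p2 * p\<^sup>2 \<le> 7 * p ^ 3"
    using mult_nonneg_nonneg[OF p(1), of "p\<^sup>2"]
    by (simp add: s_def power2_eq_square power3_eq_cube algebra_simps)
  have c12l: "s * (2 * p\<^sup>2) + p2 * (5 * p\<^sup>2) \<le> 5 * p ^ 3"
    using mult_nonneg_nonneg[OF s(1), of "p\<^sup>2"]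
    by (simp add: s_def power2_eq_square power3_eq_cube algebra_simps)
  have c3: "0 \<le> (p3 - p4) * (q0 - q4)" "(p3 - p4) * (q0 - q4) \<le> p\<^sup>2 * (4 * p)"
    using p d1 d2 d3 d4 by (auto intro!: mult_mono)
  have c4: "0 \<le> p4 * (a - q0)" "p4 * (a - q0) \<le> p\<^sup>2 * p"
    using p d0 by (auto intro!: mult_mono)
  have cube: "p\<^sup>2 * (4 * p) = 4 * p ^ 3" "p\<^sup>2 * p = p ^ 3" "0 \<le> p ^ 3"
    using p0 by (auto simp: power2_eq_square power3_eq_cube)
  show ?thesis
    unfolding X abs_le_iff using c1 c2 c12u c12l c3 c4 r(7,8) cube by auto
qed

text \<open>
  With \<open>m = 1 + s + w\<close> and \<open>Q 3 = 1 - g\<close>, where \<open>s\<close> and \<open>g\<close> are of first and \<open>w\<close> of second order,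
  the subtracted expression is \<open>1 + 3 * (s + w) - g + 3 * s\<^sup>2 - 3 * s * g\<close>, the part of
  \<open>m ^ 3 * (1 - g)\<close> up to second order, minus \<open>3 * s * (p\<^sup>2 - p3)\<close>. This term and the
  four other products in the difference are of third order and contribute \<open>16 + 27 + 36 + 27 + 3 = 109\<close>.
\<close>

lemma initial_error_bound:
  fixes p p2 p3 p4 :: real
  assumes p: "0 \<le> p2" "p2 \<le> p" "0 \<le> p4" "p4 \<le> p3" "p3 \<le> p\<^sup>2" "p \<le> 1 / 10"
  defines "m \<equiv> 1 + (p - p2) * (1 + 2 * p - 3 * p2) + (p3 - p4)"
  shows "\<bar>m ^ 3 * (1 - 3 * p + 2 * p2 + p\<^sup>2 - p3)
          - (1 - p2 + p\<^sup>2 - 6 * p2 * (p - p2) + 2 * p3 - 3 * p4)\<bar> \<le> 109 * p ^ 3"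
proof -
  define s where "s = p - p2"
  define w where "w = s * (2 * p - 3 * p2) + (p3 - p4)"
  define g where "g = 3 * p - 2 * p2 - p\<^sup>2 + p3"
  have p0: "0 \<le> p" and s: "0 \<le> s" "s \<le> p" using p by (auto simp: s_def)
  have m: "m = 1 + (s + w)" by (simp add: m_def w_def s_def algebra_simps)
  have pp: "p\<^sup>2 \<le> p / 10" using mult_left_mono[OF p(6) p0] by (simp add: power2_eq_square)
  have w: "\<bar>w\<bar> \<le> 3 * p\<^sup>2"
  proof -
    have "\<bar>s * (2 * p - 3 * p2)\<bar> \<le> p * (2 * p)"
      unfolding abs_mult using s p by (intro mult_mono) auto
    then show ?thesis using p unfolding w_def by (auto simp: power2_eq_square abs_le_iff)
  qed
  have g: "\<bar>g\<bar> \<le> 3 * p" using p pp p0 unfolding g_def by (auto simp: abs_le_iff)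
  have w': "\<bar>w\<bar> \<le> p" using w pp p0 by simp
  have h: "\<bar>s + w\<bar> \<le> 2 * p" using w' s by (auto simp: abs_le_iff)
  have eq: "m ^ 3 * (1 - 3 * p + 2 * p2 + p\<^sup>2 - p3)
      - (1 - p2 + p\<^sup>2 - 6 * p2 * (p - p2) + 2 * p3 - 3 * p4)
    = (s + w) ^ 3 * (1 - g) + 3 * (w * (2 * s + w)) - 3 * ((s + w)\<^sup>2 * g) - 3 * (w * g)
      + 3 * (s * (p\<^sup>2 - p3))"
  proof -
    have g': "1 - 3 * p + 2 * p2 + p\<^sup>2 - p3 = 1 - g"
      by (simp add: g_def)
    have nu: "1 - p2 + p\<^sup>2 - 6 * p2 * (p - p2) + 2 * p3 - 3 * p4
        = 1 + 3 * (s + w) - g + 3 * s\<^sup>2 - 3 * s * (g + (p\<^sup>2 - p3))"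
      by (simp add: g_def w_def s_def power2_eq_square algebra_simps)
    show ?thesis
      unfolding m g' nu by (simp add: power2_eq_square power3_eq_cube algebra_simps)
  qed
  have hp: "\<bar>(s + w) ^ k\<bar> \<le> (2 * p) ^ k" for k
    unfolding power_abs by (rule power_mono[OF h]) simp
  have b1: "\<bar>(s + w) ^ 3 * (1 - g)\<bar> \<le> (2 * p) ^ 3 * 2"
    by (rule abs_mult_le[OF hp]) (use g p(6) in linarith)
  have b2: "\<bar>w * (2 * s + w)\<bar> \<le> 3 * p\<^sup>2 * (3 * p)"
    by (rule abs_mult_le[OF w]) (use w' s in linarith)
  have b3: "\<bar>(s + w)\<^sup>2 * g\<bar> \<le> (2 * p)\<^sup>2 * (3 * p)"
    by (rule abs_mult_le[OF hp g])
  have b4: "\<bar>w * g\<bar> \<le> 3 * p\<^sup>2 * (3 * p)"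
    by (rule abs_mult_le[OF w g])
  have b5: "\<bar>s * (p\<^sup>2 - p3)\<bar> \<le> p * p\<^sup>2"
    by (rule abs_mult_le) (use s p in linarith)+
  have cube: "(2 * p) ^ 3 * 2 = 16 * p ^ 3" "3 * p\<^sup>2 * (3 * p) = 9 * p ^ 3"
    "(2 * p)\<^sup>2 * (3 * p) = 12 * p ^ 3" "p * p\<^sup>2 = p ^ 3"
    by (simp_all add: power2_eq_square power3_eq_cube)
  show ?thesis
    unfolding eq using b1 b2 b3 b4 b5 unfolding cube by linarith
qed

section \<open>The approximation for the recursion\<close>

context exceedance_runs
begin

lemma P_chain: "0 \<le> P 2" "P 2 \<le> P 1" "0 \<le> P 4" "P 4 \<le> P 3" "P 3 \<le> (P 1)\<^sup>2"
  using P_decreasing[of 1] P_decreasing[of 3] u_nonneg P_bounds by (simp_all add: numeral_eq_Suc)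

lemma \<mu>_ge_1:
  assumes "P 1 \<le> 1 / 10"
  shows "\<mu> \<ge> 1"
proof -
  have "0 \<le> (P 1 - P 2) * (1 + 2 * P 1 - 3 * P 2)"
    using P_chain assms by (intro mult_nonneg_nonneg) auto
  then show ?thesis using P_chain by (simp add: \<mu>_eq)
qed

lemma Q_step: "\<bar>\<mu> * Q (m + 4) - Q (m + 3)\<bar> \<le> 12 * (P 1) ^ 3"
proof -
  have diff: "Q (m + i) - Q (m + Suc i) = u (m + i) 1" for i
    using Q_diff[of "m + i"] by simp
  have diffs: "Q m - Q (m + 1) = u m 1" "Q (m + 1) - Q (m + 2) = u (m + 1) 1"
     "Q (m + 2) - Q (m + 3) = u (m + 2) 1" "Q (m + 3) - Q (m + 4) = u (m + 3) 1"
    using diff[of 0] diff[of 1] diff[of 2] diff[of 3] by (simp_all add: numeral_eq_Suc)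
  have s1: "u (m + 1) k = Q m * P k - u m (Suc k)"
   and s2: "u (m + 2) k = Q (m + 1) * P k - u (m + 1) (Suc k)"
   and s3: "u (m + 3) k = Q (m + 2) * P k - u (m + 2) (Suc k)" for k
    using u_split[of m k] u_split[of "m + 1" k] u_split[of "m + 2" k]
    by (simp_all add: numeral_eq_Suc)
  obtain r3 where r3: "u m 2 = Q_prev m * P 2 - r3" "0 \<le> r3" "r3 \<le> P 3"
    using u_split_prev[of m 2] by (auto simp: numeral_eq_Suc)
  obtain r5 where r5: "u m 4 = Q_prev m * P 4 - r5" "0 \<le> r5" "r5 \<le> P 5"
    using u_split_prev[of m 4] by (auto simp: numeral_eq_Suc)
  have e2: "Q (m + 1) - Q (m + 2) = P 1 * Q m - P 2 * Q_prev m + r3"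
    using diffs(2) s1[of 1] r3(1) by (simp add: numeral_eq_Suc algebra_simps)
  have e3: "Q (m + 2) - Q (m + 3) = P 1 * Q (m + 1) - P 2 * Q m + u m 3"
    using diffs(3) s2[of 1] s1[of 2] by (simp add: numeral_eq_Suc algebra_simps)
  have e4: "Q (m + 3) - Q (m + 4) = P 1 * Q (m + 2) - P 2 * Q (m + 1) + u (m + 1) 3"
    using diffs(4) s3[of 1] s2[of 2] by (simp add: numeral_eq_Suc algebra_simps)
  have e4': "Q (m + 3) - Q (m + 4) =
      P 1 * Q (m + 2) - P 2 * Q (m + 1) + P 3 * Q m - P 4 * Q_prev m + r5"
    using e4 s1[of 3] r5(1) by (simp add: numeral_eq_Suc algebra_simps)
  have d: "0 \<le> Q m - Q (m + 1)" "Q m - Q (m + 1) \<le> P 1"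
      "0 \<le> Q (m + 1) - Q (m + 2)" "Q (m + 1) - Q (m + 2) \<le> P 1"
      "0 \<le> Q (m + 2) - Q (m + 3)" "Q (m + 2) - Q (m + 3) \<le> P 1"
      "0 \<le> Q (m + 3) - Q (m + 4)" "Q (m + 3) - Q (m + 4) \<le> P 1"
    unfolding diffs by (rule u_nonneg u_le_P)+
  show ?thesis
    unfolding \<mu>_eq
    by (rule one_step_error_bound[OF P_chain u_nonneg Q_prev_diff d e2 e3 e4 e4' r3(2,3)
          u_nonneg u_le_P u_nonneg u_le_P r5(2) order_trans[OF r5(3) P_bounds(2)]])
qed

text \<open>
  The error \<open>e\<close> at one index and the one-step defect \<open>d\<close> give the error \<open>(e + d) / \<mu>\<close> at the next.
  As \<open>\<mu> \<ge> 1\<close>, errors never grow by more than the defect.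
\<close>

lemma Q_approx:
  assumes p: "P 1 \<le> 1 / 10"
  shows "\<bar>Q (m + 3) - \<nu> / \<mu> ^ (m + 3)\<bar> \<le> (109 + 12 * real m) * (P 1) ^ 3"
proof (induction m)
  case 0
  have \<mu>: "\<mu> \<ge> 1" by (rule \<mu>_ge_1[OF p])
  have "Q 3 - \<nu> / \<mu> ^ 3 = (\<mu> ^ 3 * Q 3 - \<nu>) / \<mu> ^ 3"
    using \<mu> by (simp add: field_simps)
  then have "\<bar>Q 3 - \<nu> / \<mu> ^ 3\<bar> = \<bar>\<mu> ^ 3 * Q 3 - \<nu>\<bar> / \<mu> ^ 3"
    using \<mu> by (simp add: abs_divide)
  also have "\<dots> \<le> \<bar>\<mu> ^ 3 * Q 3 - \<nu>\<bar>"
    using \<mu> by (intro divide_le_numerator) auto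
  also have "\<dots> \<le> 109 * (P 1) ^ 3"
    unfolding \<mu>_eq \<nu>_eq Q_first(3) by (rule initial_error_bound[OF P_chain p])
  finally show ?case by simp
next
  case (Suc m)
  have \<mu>: "\<mu> \<ge> 1" by (rule \<mu>_ge_1[OF p])
  define e where "e = Q (m + 3) - \<nu> / \<mu> ^ (m + 3)"
  define d where "d = \<mu> * Q (m + 4) - Q (m + 3)"
  have "Q (Suc m + 3) - \<nu> / \<mu> ^ (Suc m + 3) = (e + d) / \<mu>"
    using \<mu> unfolding e_def d_def by (simp add: field_simps numeral_eq_Suc)
  then have "\<bar>Q (Suc m + 3) - \<nu> / \<mu> ^ (Suc m + 3)\<bar> = \<bar>e + d\<bar> / \<mu>"
    using \<mu> by (simp add: abs_divide)
  also have "\<dots> \<le> \<bar>e + d\<bar>"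
    using \<mu> by (intro divide_le_numerator) auto
  also have "\<dots> \<le> \<bar>e\<bar> + \<bar>d\<bar>" by simp
  also have "\<dots> \<le> (109 + 12 * real m) * (P 1) ^ 3 + 12 * (P 1) ^ 3"
    using Suc.IH Q_step[of m] unfolding e_def d_def by (intro add_mono) auto
  finally show ?case by (simp add: algebra_simps)
qed

end

section \<open>Runs in a stationary one-dependent sequence\<close>

definition run :: "'a measure \<Rightarrow> (nat \<Rightarrow> 'a \<Rightarrow> real) \<Rightarrow> real \<Rightarrow> nat \<Rightarrow> nat \<Rightarrow> 'a set" where
  "run M X x h k = {\<omega> \<in> space M. \<forall>i\<in>{h + 1..h + k}. x < X i \<omega>}"

definition below :: "'a measure \<Rightarrow> (nat \<Rightarrow> 'a \<Rightarrow> real) \<Rightarrow> real \<Rightarrow> nat \<Rightarrow> 'a set" where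
  "below M X x m = {\<omega> \<in> space M. \<forall>i\<in>{1..m}. X i \<omega> \<le> x}"

lemma all_in_generated_sigma_field:
  assumes "J \<subseteq> I" "finite J" "B \<in> sets borel"
  shows "{\<omega> \<in> space M. \<forall>i\<in>J. X i \<omega> \<in> B} \<in> generated_sigma_field M X I"
proof -
  interpret sigma_algebra "space M" "generated_sigma_field M X I"
    unfolding generated_sigma_field_def by (rule sigma_algebra_sigma_sets) auto
  have "{\<omega> \<in> space M. X i \<omega> \<in> B} \<in> generated_sigma_field M X I" if "i \<in> J" for i
  proof -
    have "X i -` B \<inter> space M \<in> generated_sigma_field M X I"
      unfolding generated_sigma_field_def using that assms by (intro sigma_sets.Basic) auto
    moreover have "X i -` B \<inter> space M = {\<omega> \<in> space M. X i \<omega> \<in> B}" by auto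
    ultimately show ?thesis by simp
  qed
  then show ?thesis using assms(2) by (rule sets_Collect_finite_All)
qed

lemma run_in_generated_sigma_field:
  assumes "{h + 1..h + k} \<subseteq> I"
  shows "run M X x h k \<in> generated_sigma_field M X I"
  using all_in_generated_sigma_field[OF assms, of "{x<..}"] by (simp add: run_def)

lemma below_in_generated_sigma_field: "below M X x m \<in> generated_sigma_field M X {1..m}"
  using all_in_generated_sigma_field[of "{1..m}" "{1..m}" "{..x}"] by (simp add: below_def)

text \<open>
  Stationarity makes the probability of a run of exceedances independent of its position; together
  with one-dependence this factorizes events separated by one free index. For \<open>u_split\<close> the event
  with a free index \<open>m + 1\<close> is divided according to whether \<open>X (m + 1)\<close> exceeds \<open>x\<close>. The
  independence assumption speaks only of a nonempty initial block, so \<open>m = 0\<close> and \<open>k = 0\<close> are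
  covered by stationarity alone.
\<close>

lemma exceedance_runs_of_sequence:
  fixes M :: "'a measure" and X :: "nat \<Rightarrow> 'a \<Rightarrow> real" and x :: real
  assumes M: "prob_space M"
    and X: "\<And>i. i \<ge> 1 \<Longrightarrow> X i \<in> borel_measurable M"
    and stat: "strictly_stationary M X"
    and dep: "one_dependent M X"
  shows "exceedance_runs (\<lambda>m k. measure M (below M X x m \<inter> run M X x m k))"
proof -
  interpret prob_space M by (rule M)
  have sets_run [measurable]: "run M X x h k \<in> sets M" for h k
  proof -
    have [measurable]: "X i \<in> borel_measurable M" if "i \<in> {h + 1..h + k}" for i
      using X that by simp
    show ?thesis unfolding run_def by measurable
  qed
  have sets_below [measurable]: "below M X x m \<in> sets M" for m
  proof -
    have [measurable]: "X i \<in> borel_measurable M" if "i \<in> {1..m}" for i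
      using X that by simp
    show ?thesis unfolding below_def by measurable
  qed
  have run_shift: "prob (run M X x h k) = prob (run M X x 0 k)" for h k
  proof -
    let ?J = "{1..k}" and ?P = "PiM {1..k} (\<lambda>_. borel :: real measure)"
    let ?S = "{f \<in> space ?P. \<forall>i\<in>?J. x < f i}"
    have S: "?S \<in> sets ?P" by measurable
    have meas: "(\<lambda>\<omega>. \<lambda>i\<in>?J. X (i + g) \<omega>) \<in> measurable M ?P" for g
      using X by (intro measurable_restrict) auto
    have pre: "(\<lambda>\<omega>. \<lambda>i\<in>?J. X (i + g) \<omega>) -` ?S \<inter> space M = run M X x g k" for g
    proof -
      have in_S: "(\<lambda>i\<in>?J. X (i + g) \<omega>) \<in> ?S \<longleftrightarrow> (\<forall>i\<in>{1..k}. x < X (i + g) \<omega>)"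
        if "\<omega> \<in> space M" for \<omega>
        using measurable_space[OF meas that] by simp
      have "\<omega> \<in> (\<lambda>\<omega>. \<lambda>i\<in>?J. X (i + g) \<omega>) -` ?S \<inter> space M \<longleftrightarrow> \<omega> \<in> run M X x g k" for \<omega>
      proof (cases "\<omega> \<in> space M")
        case True
        have "\<omega> \<in> run M X x g k \<longleftrightarrow> (\<forall>i\<in>{1..k}. x < X (i + g) \<omega>)"
        proof
          assume "\<omega> \<in> run M X x g k"
          then show "\<forall>i\<in>{1..k}. x < X (i + g) \<omega>" by (simp add: run_def)
        next
          assume *: "\<forall>i\<in>{1..k}. x < X (i + g) \<omega>"
          have "x < X i \<omega>" if "i \<in> {g + 1..g + k}" for i
          proof -
            have "i - g \<in> {1..k}" "i - g + g = i" using that by auto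
            then show ?thesis using bspec[OF *, of "i - g"] by simp
          qed
          then show "\<omega> \<in> run M X x g k" using True by (simp add: run_def)
        qed
        then show ?thesis using in_S[OF True] True by (simp only: Int_iff vimage_eq simp_thms)
      qed (simp add: run_def)
      then show ?thesis by (rule set_eqI)
    qed
    have "measure (distr M ?P (\<lambda>\<omega>. \<lambda>i\<in>?J. X (i + g) \<omega>)) ?S = prob (run M X x g k)" for g
      using measure_distr[OF meas S] pre by simp
    note prob_eq = this
    have "distr M ?P (\<lambda>\<omega>. \<lambda>i\<in>?J. X (i + h) \<omega>) = distr M ?P (\<lambda>\<omega>. \<lambda>i\<in>?J. X (i + 0) \<omega>)"
      using stat[unfolded strictly_stationary_def, rule_format, of ?J h] by auto
    then show ?thesis using prob_eq[of h] prob_eq[of 0] by (simp only:)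
  qed
  have gap: "prob (A \<inter> run M X x (Suc t) k) = prob A * prob (run M X x 0 k)"
    if "t \<ge> 1" "A \<in> generated_sigma_field M X {1..t}" for t k A
  proof -
    have "run M X x (Suc t) k \<in> generated_sigma_field M X {t + 2..}"
      by (rule run_in_generated_sigma_field) auto
    moreover have "indep_set (generated_sigma_field M X {1..t}) (generated_sigma_field M X {t + 2..})"
      using dep that(1) by (simp add: one_dependent_def)
    ultimately have "prob (A \<inter> run M X x (Suc t) k) = prob A * prob (run M X x (Suc t) k)"
      using that(2) by (intro indep_setD)
    then show ?thesis by (simp only: run_shift[of "Suc t" k])
  qed
  have below_0: "below M X x 0 = space M" by (simp add: below_def)
  have run_0: "run M X x h 0 = space M" for h by (simp add: run_def)
  have run_sub: "run M X x h k \<subseteq> space M" for h k by (auto simp: run_def)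
  have below_sub: "below M X x h \<subseteq> space M" for h by (auto simp: below_def)
  show ?thesis
  proof
    fix m k
    show "0 \<le> prob (below M X x m \<inter> run M X x m k)" by simp
    show "prob (below M X x 0 \<inter> run M X x 0 0) = 1"
      by (simp add: below_0 run_0 prob_space)
    have ivl: "{Suc m..Suc (m + k)} = insert (Suc m) {Suc (Suc m)..Suc (m + k)}" by auto
    have ivl': "{Suc 0..Suc m} = insert (Suc m) {Suc 0..m}" by auto
    have union: "below M X x m \<inter> run M X x (Suc m) k =
        (below M X x (Suc m) \<inter> run M X x (Suc m) k) \<union> (below M X x m \<inter> run M X x m (Suc k))"
      unfolding below_def run_def by (auto simp: ivl ivl' not_le)
    have disj: "(below M X x (Suc m) \<inter> run M X x (Suc m) k) \<inter>
        (below M X x m \<inter> run M X x m (Suc k)) = {}"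
      unfolding below_def run_def by (auto simp: ivl ivl' not_le)
    have "prob (below M X x m \<inter> run M X x (Suc m) k)
        = prob (below M X x m) * prob (run M X x 0 k)"
    proof (cases "m = 0")
      case True
      then show ?thesis
        using run_shift[of 1 k] run_sub by (simp add: below_0 prob_space Int_absorb1)
    next
      case False
      then show ?thesis by (intro gap below_in_generated_sigma_field) auto
    qed
    then show "prob (below M X x (Suc m) \<inter> run M X x (Suc m) k)
        + prob (below M X x m \<inter> run M X x m (Suc k))
        = prob (below M X x m \<inter> run M X x m 0) * prob (below M X x 0 \<inter> run M X x 0 k)"
      using finite_measure_Union[OF _ _ disj] union run_sub below_sub
      by (simp add: below_0 run_0 Int_absorb1 Int_absorb2)
    have "prob (run M X x 0 (Suc (Suc k))) \<le> prob (run M X x 0 k \<inter> run M X x (Suc k) 1)"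
      by (intro finite_measure_mono sets.Int sets_run) (auto simp: run_def)
    also have "\<dots> = prob (run M X x 0 k) * prob (run M X x 0 1)"
    proof (cases "k = 0")
      case True
      then show ?thesis
        using run_shift[of 1 1] run_sub by (simp add: run_0 prob_space Int_absorb1)
    next
      case False
      then show ?thesis by (intro gap run_in_generated_sigma_field) auto
    qed
    finally show "prob (below M X x 0 \<inter> run M X x 0 (Suc (Suc k)))
        \<le> prob (below M X x 0 \<inter> run M X x 0 k) * prob (below M X x 0 \<inter> run M X x 0 1)"
      using run_sub by (simp add: below_0 Int_absorb1)
  qed
qed

lemma q_eq_below:
  assumes "n \<ge> 1"
  shows "q M X x n = measure M (below M X x n \<inter> run M X x n 0)"
proof -
  have "{\<omega> \<in> space M. Max ((\<lambda>i. X i \<omega>) ` {1..n}) \<le> x} = below M X x n \<inter> run M X x n 0"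
    using assms by (auto simp: below_def run_def)
  then show ?thesis by (simp add: q_def)
qed

section \<open>Lower bounds for the constants\<close>

text \<open>
  A root \<open>t \<ge> 0\<close> satisfies \<open>t = 1 + \<alpha> * t ^ 3 \<ge> 1\<close>, so only a second negative root could make the
  second smallest root smaller than 1. Two distinct negative roots \<open>a\<close>, \<open>b\<close> would satisfy
  \<open>\<alpha> * (a\<^sup>2 + a * b + b\<^sup>2) = 1\<close>, hence \<open>\<alpha> * a\<^sup>2 < 1\<close>, which contradicts \<open>a * (1 - \<alpha> * a\<^sup>2) = 1\<close>.
  Sign changes on \<open>{- 2 / \<alpha>..0}\<close> and \<open>{1..2}\<close> provide two roots, so that the list defining \<open>t2\<close>
  does have a second entry.
\<close>

lemma t2_ge_1:
  assumes \<alpha>: "0 < \<alpha>" "\<alpha> \<le> 1 / 10"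
  shows "t2 \<alpha> \<ge> 1"
proof -
  define S where "S = {t. \<alpha> * t ^ 3 - t + 1 = 0}"
  have "S = {t. poly [:1, -1, 0, \<alpha>:] t = 0}"
    by (simp add: S_def algebra_simps power3_eq_cube)
  then have fin: "finite S"
    using poly_roots_finite[of "[:1, -1, 0, \<alpha>:]"] by simp
  have ge1: "t \<ge> 1" if "t \<in> S" "t \<ge> 0" for t
  proof -
    have "0 \<le> \<alpha> * t ^ 3" using that(2) \<alpha> by simp
    then show ?thesis using that(1) by (simp add: S_def)
  qed
  have neg: "a = b" if "a \<in> S" "b \<in> S" "a < 0" "b < 0" for a b
  proof (rule ccontr)
    assume "a \<noteq> b"
    have "(a - b) * (\<alpha> * (a\<^sup>2 + a * b + b\<^sup>2) - 1) = 0"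
      using that by (simp add: S_def power2_eq_square power3_eq_cube algebra_simps)
    then have "\<alpha> * (a\<^sup>2 + a * b + b\<^sup>2) = 1" using \<open>a \<noteq> b\<close> by simp
    moreover have "\<alpha> * (a\<^sup>2 + a * b + b\<^sup>2) > \<alpha> * a\<^sup>2"
      using \<alpha> that by (intro mult_strict_left_mono) (auto simp: mult_neg_neg add_pos_nonneg)
    ultimately have "1 - \<alpha> * a\<^sup>2 > 0" by simp
    then have "a * (1 - \<alpha> * a\<^sup>2) < 0" using that by (simp add: mult_less_0_iff)
    moreover have "a * (1 - \<alpha> * a\<^sup>2) = 1"
      using that(1) by (simp add: S_def power2_eq_square power3_eq_cube algebra_simps)
    ultimately show False by simp
  qed
  have cont: "continuous_on I (\<lambda>t. \<alpha> * t ^ 3 - t + 1)" for I :: "real set"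
    by (intro continuous_intros)
  obtain a where a: "a \<in> S" "a \<le> 0"
  proof -
    have "\<alpha> * (- (2 / \<alpha>)) ^ 3 - (- (2 / \<alpha>)) + 1 \<le> 0"
    proof -
      have "\<alpha> * (- (2 / \<alpha>)) ^ 3 - (- (2 / \<alpha>)) + 1 = (\<alpha>\<^sup>2 + 2 * \<alpha> - 8) / \<alpha>\<^sup>2"
        using \<alpha> by (simp add: field_simps power2_eq_square power3_eq_cube)
      moreover have "\<alpha>\<^sup>2 + 2 * \<alpha> - 8 \<le> 0"
        using \<alpha> power_mono[of \<alpha> "1/10" 2] by (simp add: power2_eq_square)
      ultimately show ?thesis using \<alpha> by (simp add: divide_nonpos_pos)
    qed
    then show ?thesis
      using IVT'[of "\<lambda>t. \<alpha> * t ^ 3 - t + 1" "- (2 / \<alpha>)" 0 0] \<alpha> cont that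
      by (auto simp: S_def)
  qed
  obtain b where b: "b \<in> S" "b \<ge> 1"
    using IVT2'[of "\<lambda>t. \<alpha> * t ^ 3 - t + 1" 2 0 1] \<alpha> cont by (auto simp: S_def)
  have "card {a, b} \<le> card S" using a b fin by (intro card_mono) auto
  then have len: "2 \<le> card S" using a b by auto
  let ?xs = "sorted_list_of_set S"
  have lt: "?xs ! 0 < ?xs ! 1"
    using strict_sorted_list_of_set[of S] len fin by (simp add: sorted_wrt_iff_nth_less)
  have mem: "?xs ! 0 \<in> S" "?xs ! 1 \<in> S"
    using len fin nth_mem[of 0 ?xs] nth_mem[of 1 ?xs] by auto
  have "?xs ! 1 \<ge> 0"
  proof (rule ccontr)
    assume "\<not> ?xs ! 1 \<ge> 0"
    then show False using neg[of "?xs ! 0" "?xs ! 1"] mem lt by auto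
  qed
  then show ?thesis using ge1 mem unfolding t2_def S_def by auto
qed

text \<open>
  The outer denominator lies between 0 and 1 and can only increase the quotient. In the numerator, the first
  summand is at least its value 11 at \<open>\<alpha> = 0\<close>. With \<open>y = \<alpha> * (1 + l * \<alpha>)\<^sup>2\<close>, the inner fraction
  is \<open>(2 * (1 - y) + l * \<alpha> * (3 + y)) / (1 - y) ^ 3 \<ge> 2\<close>, and its factor is at least 2.
\<close>

lemma K_ge_15:
  assumes \<alpha>: "0 \<le> \<alpha>" "\<alpha> \<le> 1 / 10" and l: "l \<ge> 1" and pd: "positive_denominators l \<alpha>"
  shows "K l \<alpha> \<ge> 15"
proof -
  define y where "y = \<alpha> * (1 + l * \<alpha>)\<^sup>2"
  have y: "0 \<le> y" "y < 1"
    using pd \<alpha> by (auto simp: y_def positive_denominators_def \<eta>_def)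
  have la: "0 \<le> l * \<alpha>" using l \<alpha> by simp
  have A: "(11 - 3 * \<alpha>) / (1 - \<alpha>)\<^sup>2 \<ge> 11"
  proof -
    have "\<alpha> * \<alpha> \<le> \<alpha> * 1" using \<alpha> by (intro mult_left_mono) auto
    then have "11 * (1 - \<alpha>)\<^sup>2 \<le> 11 - 3 * \<alpha>"
      using \<alpha> by (simp add: power2_eq_square algebra_simps)
    moreover have "0 < (1 - \<alpha>)\<^sup>2" using \<alpha> by simp
    ultimately show ?thesis by (simp only: pos_le_divide_eq)
  qed
  have B: "(2 + 3 * l * \<alpha> - \<alpha> * (2 - l * \<alpha>) * (1 + l * \<alpha>)\<^sup>2) / (1 - y) ^ 3 \<ge> 2"
  proof -
    have "(1 - y) ^ 3 \<le> (1 - y) ^ 1" using y by (intro power_decreasing) auto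
    moreover have "2 + 3 * l * \<alpha> - \<alpha> * (2 - l * \<alpha>) * (1 + l * \<alpha>)\<^sup>2
        = 2 * (1 - y) + (3 * (l * \<alpha>) + y * (l * \<alpha>))"
      by (simp add: y_def power2_eq_square algebra_simps)
    moreover have "0 \<le> 3 * (l * \<alpha>) + y * (l * \<alpha>)" using y la by simp
    ultimately have "2 * (1 - y) ^ 3 \<le> 2 + 3 * l * \<alpha> - \<alpha> * (2 - l * \<alpha>) * (1 + l * \<alpha>)\<^sup>2"
      by simp
    then show ?thesis using y by (simp add: le_divide_eq)
  qed
  have C: "2 * l * (1 + 3 * \<alpha>) \<ge> 2"
    using mult_mono[OF l, of 1 "1 + 3 * \<alpha>"] \<alpha> l by simp
  have num: "15 \<le> (11 - 3 * \<alpha>) / (1 - \<alpha>)\<^sup>2 + 2 * l * (1 + 3 * \<alpha>)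
      * ((2 + 3 * l * \<alpha> - \<alpha> * (2 - l * \<alpha>) * (1 + l * \<alpha>)\<^sup>2) / (1 - y) ^ 3)" (is "_ \<le> ?N")
    using A mult_mono[OF C B] C by simp
  let ?D = "1 - 2 * \<alpha> * (1 + l * \<alpha>) / (1 - y)\<^sup>2"
  have D: "0 < ?D" "?D \<le> 1"
    using pd \<alpha> la by (auto simp: positive_denominators_def \<eta>_def y_def)
  have "15 * ?D \<le> 15 * 1" using D(2) by (rule mult_left_mono) simp
  then have "15 * ?D \<le> ?N" using num by linarith
  then have "15 \<le> ?N / ?D" using D(1) by (simp add: pos_le_divide_eq)
  then show ?thesis by (simp add: K_def y_def)
qed

lemma L_ge_100:
  assumes \<alpha>: "0 \<le> \<alpha>" and K: "K l \<alpha> \<ge> 15"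
  shows "L l \<alpha> \<ge> 100"
proof -
  have a: "1 + \<alpha> + 3 * \<alpha>\<^sup>2 \<ge> 1" "1 + \<alpha> + 3 * \<alpha>\<^sup>2 + K l \<alpha> * \<alpha> ^ 3 \<ge> 1"
    using \<alpha> K by auto
  have "15 * 1 * 1 \<le> K l \<alpha> * (1 + \<alpha> + 3 * \<alpha>\<^sup>2) * (1 + \<alpha> + 3 * \<alpha>\<^sup>2 + K l \<alpha> * \<alpha> ^ 3)"
    using a K by (intro mult_mono) auto
  moreover have "0 \<le> \<alpha> ^ 6 * K l \<alpha> ^ 3" "0 \<le> 9 * \<alpha> * (4 + 3 * \<alpha> + 3 * \<alpha>\<^sup>2)"
    using \<alpha> K by auto
  ultimately show ?thesis unfolding L_def by linarith
qed

lemma E_nonneg: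
  assumes \<alpha>: "0 \<le> \<alpha>" "\<alpha> \<le> 1 / 10" and l: "l \<ge> 0" and pd: "positive_denominators l \<alpha>"
  shows "E l \<alpha> \<ge> 0"
proof -
  have \<eta>: "\<eta> l \<alpha> \<ge> 1" using \<alpha> l by (simp add: \<eta>_def)
  have "\<alpha> * (\<eta> l \<alpha> - 2) \<ge> \<alpha> * (- 1)" using \<eta> \<alpha>(1) by (intro mult_left_mono) auto
  then have 1: "1 + \<alpha> * (\<eta> l \<alpha> - 2) \<ge> 0" using \<alpha> by simp
  have 2: "1 + \<eta> l \<alpha> + (1 - 3 * \<alpha>) * (\<eta> l \<alpha>)\<^sup>2 \<ge> 0"
    using \<alpha> \<eta> by (intro add_nonneg_nonneg mult_nonneg_nonneg) auto
  have 3: "(1 + (1 - 2 * \<alpha>) * \<eta> l \<alpha>) ^ 4 \<ge> 0" by simp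
  have 4: "\<eta> l \<alpha> ^ 5 \<ge> 0" using \<eta> by simp
  show ?thesis
    using pd unfolding E_def positive_denominators_def
    by (intro add_nonneg_nonneg divide_nonneg_nonneg mult_nonneg_nonneg 1 2 3 4) auto
qed

theorem theorem2p5:
  fixes M :: "'a measure" and X :: "nat \<Rightarrow> 'a \<Rightarrow> real"
    and x \<alpha> l :: real and n :: nat
  assumes "prob_space M"
    and "\<And>i. i \<ge> 1 \<Longrightarrow> X i \<in> borel_measurable M"
    and "strictly_stationary M X"
    and "one_dependent M X"
    and "Inf (ereal ` {u. F M X u > 0}) < ereal x"
    and "ereal x < Sup (ereal ` {u. F M X u < 1})"
    and "q M X x 1 \<ge> 1 - \<alpha>" and "1 - \<alpha> \<ge> 0.9"
    and "l > t2 \<alpha> ^ 3"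
    and "positive_denominators l \<alpha>"
    and "n \<ge> 3"
  shows "\<bar>q M X x n -
            (6 * (q M X x 1 - q M X x 2)\<^sup>2 + 4 * q M X x 3 - 3 * q M X x 4)
            / (1 + q M X x 1 - q M X x 2 + q M X x 3 - q M X x 4
                 + 2 * (q M X x 1)\<^sup>2 + 3 * (q M X x 2)\<^sup>2 - 5 * q M X x 1 * q M X x 2) ^ n\<bar>
         \<le> \<Delta>\<^sub>1 l \<alpha> n * (1 - q M X x 1) ^ 3"
proof -
  interpret exceedance_runs "\<lambda>m k. measure M (below M X x m \<inter> run M X x m k)"
    by (rule exceedance_runs_of_sequence[OF assms(1-4)])
  have q: "q M X x i = Q i" if "i \<ge> 1" for i
    using that by (rule q_eq_below)
  define p where "p = 1 - q M X x 1"
  have P1: "P 1 = p" using Q_first(1) q[of 1] by (simp add: p_def)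
  have p: "0 \<le> p" "p \<le> \<alpha>" "\<alpha> \<le> 1 / 10" "p \<le> 1 / 10"
    using assms(7,8) u_nonneg[of 0 1] unfolding P1 by (simp_all add: p_def)
  define m where "m = n - 3"
  have n: "n = m + 3" using assms(11) by (simp add: m_def)
  have "\<bar>q M X x n - \<nu> / \<mu> ^ n\<bar> \<le> (109 + 12 * real m) * p ^ 3"
    using Q_approx[of m] p P1 q[of n] n by simp
  \<comment> \<open>For \<open>p = 0\<close> both sides vanish; otherwise \<open>\<alpha> \<ge> p > 0\<close>, so the cubic defining \<open>t2 \<alpha>\<close> is genuine.\<close>
  also have "\<dots> \<le> \<Delta>\<^sub>1 l \<alpha> n * p ^ 3"
  proof (cases "p = 0")
    case False
    then have \<alpha>: "0 < \<alpha>" using p by simp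
    have "1 \<le> t2 \<alpha> ^ 3" using t2_ge_1[OF \<alpha> p(3)] by (rule one_le_power)
    then have l: "l \<ge> 1" using assms(9) by simp
    have K: "K l \<alpha> \<ge> 15" using K_ge_15[OF _ p(3) l assms(10)] \<alpha> by simp
    have "\<Gamma> l \<alpha> \<ge> 100"
      using L_ge_100[OF _ K] E_nonneg[OF _ p(3) _ assms(10)] \<alpha> l by (simp add: \<Gamma>_def)
    moreover have "real n * K l \<alpha> \<ge> real n * 15" using K by (rule mult_left_mono) simp
    ultimately have "109 + 12 * real m \<le> \<Delta>\<^sub>1 l \<alpha> n" by (simp add: \<Delta>\<^sub>1_def n)
    then show ?thesis using p by (intro mult_right_mono) auto
  qed simp
  finally show ?thesis unfolding p_def \<nu>_def \<mu>_def q[symmetric] by (simp add: q)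
qed

end
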